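(* Let $x:[0,1]\to\mathbb{R}$ be a continuous function such that for every $0\le c<d\le1$ there exist partitions $(\hat\pi_n)_n$ of $[c,d]$ such that $\lim_n\langle x\rangle^{\hat\pi_n}_{(c,d]}=\infty$. Then, if $a:[0,1]\to[0,\infty)$ is an increasing (i.e. nondecreasing) function such that $a_0=0$, there exist refining partitions $(\pi_n)_n$ of $[0,1]$ such that $D_n\subseteq\pi_n$ for all $n$ and $$\langle x\rangle^{\pi_n}_t\to a_t\quad\text{for all }t\in[0,1]\text{ as }n\to\infty,$$ and the convergence is uniform if $a$ is continuous. Moreover, given arbitrary partitions $(\bar\pi_n)_n$ of $[0,1]$, one can choose $(\pi_n)_n$ such that $\bar\pi_n\subseteq\pi_n$ for all $n$.
   Context: A partition of a compact interval $[c,d]$ is a finite sequence $\pi=(t_i)_{i=0}^k$ with $t_0=c$, $t_i<t_{i+1}$ for all $i$, and $t_k=d$ (also regarded as a finite set). A sequence of partitions is refining if $\pi_n\subseteq\pi_{n+1}$ for all $n$. For a partition $\pi$ of $[c,d]$, $\langle x\rangle^{\pi}_{(c,d]}:=\sum_i(x_{t_{i+1}}-x_{t_i})^2$, and for a partition $\pi$ of $[0,1]$ and $t\in[0,1]$, $\langle x\rangle^{\pi}_t:=\sum_i(x_{t_{i+1}\wedge t}-x_{t_i\wedge t})^2$. $D_n:=[0,1]\cap\mathbb{N}2^{-n}$ are the dyadics of order $n$ in $[0,1]$. No right-continuity of $a$ is assumed. *)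

theory Defs
  imports "HOL-Analysis.Analysis"
begin

text \<open>
  A partition \<open>\<pi> = (t\<^sub>0, \<dots>, t\<^sub>k)\<close> of \<open>[c, d]\<close> is the strictly increasing list of its points;
  where a partition is regarded as a finite set, this is \<open>set \<pi>\<close>.
\<close>
definition partition_of :: "real \<Rightarrow> real \<Rightarrow> real list \<Rightarrow> bool" where
  "partition_of c d \<pi> \<longleftrightarrow> \<pi> \<noteq> [] \<and> hd \<pi> = c \<and> last \<pi> = d \<and> sorted_wrt (<) \<pi>"

text \<open>
  \<open>quad_var x \<pi>\<close> is the sum of squared increments of \<open>x\<close> over all of \<open>\<pi>\<close>, that is,
  \<open>\<langle>x\<rangle>\<close> on \<open>(c, d]\<close> for a partition \<open>\<pi>\<close> of \<open>[c, d]\<close>.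
\<close>
definition quad_var :: "(real \<Rightarrow> real) \<Rightarrow> real list \<Rightarrow> real" where
  "quad_var x \<pi> = (\<Sum>i<length \<pi> - 1. (x (\<pi> ! Suc i) - x (\<pi> ! i))\<^sup>2)"

definition quad_var_upto :: "(real \<Rightarrow> real) \<Rightarrow> real list \<Rightarrow> real \<Rightarrow> real" where
  "quad_var_upto x \<pi> t = (\<Sum>i<length \<pi> - 1. (x (min (\<pi> ! Suc i) t) - x (min (\<pi> ! i) t))\<^sup>2)"

definition refining :: "(nat \<Rightarrow> real list) \<Rightarrow> bool" where
  "refining \<pi> \<longleftrightarrow> (\<forall>n. set (\<pi> n) \<subseteq> set (\<pi> (Suc n)))"

definition unit_dyadics :: "nat \<Rightarrow> real set" where
  "unit_dyadics n = {0..1} \<inter> range (\<lambda>k::nat. real k / 2 ^ n)"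

end

theory Submission
  imports Defs
begin

text \<open>
  On any interval the quadratic variation along partitions takes every value \<open>v \<ge> 0\<close> up to an
  arbitrarily small error. It can be made small, because the intermediate value theorem
  splits the increment of a continuous \<open>x\<close> into two equal halves at some intermediate time, and
  each round of such splittings halves the sum of squares (\<open>partition_small_quad_var\<close>). It can be
  made large by hypothesis. To reach \<open>v\<close> (\<open>partition_prescribed_quad_var\<close>), take a partition
  \<open>\<rho>\<close> whose quadratic variation is at least \<open>v\<close>; since \<open>t \<mapsto> quad_var_upto x \<rho> t\<close> is continuous and
  starts at \<open>0\<close>, it equals \<open>v\<close> at some \<open>t\<close>. Keep \<open>\<rho>\<close> up to \<open>t\<close> and continue from \<open>t\<close>
  with a partition of negligible quadratic variation.

  Only the end points of the interval are constrained here, so any finite set of points can be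
  imposed: apply the above between consecutive imposed points, with \<open>v\<close> the
  increment of \<open>a\<close>. The result contains the imposed points and has quadratic variation close to
  \<open>a\<close> at each of them, with a total error as small as desired
  (\<open>refine_with_prescribed_quad_var_upto\<close>). Imposing all points of the previous partition makes
  the sequence refining.

  The values between imposed points follow by monotonicity. The function
  \<open>t \<mapsto> quad_var_upto x \<rho> t\<close> is not monotone, but the only obstruction is the square of
  the last, incomplete increment, which vanishes with the mesh by uniform continuity of \<open>x\<close>.
  So for imposed points \<open>p \<le> t \<le> q\<close> the value at \<open>t\<close> lies between \<open>a p\<close> and
  \<open>a q\<close> up to small errors. As the dyadics of order \<open>n\<close> are imposed, this gives convergence at
  each continuity point of \<open>a\<close>, and uniform convergence if \<open>a\<close> is (uniformly)
  continuous. The monotone function \<open>a\<close> has only countably many discontinuities; imposing the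
  first \<open>n\<close> of them in step \<open>n\<close> gives convergence there as well.
\<close>

section \<open>Quadratic variation along lists of times\<close>

lemma quad_var_singleton [simp]: "quad_var x [c] = 0"
  by (simp add: quad_var_def)

lemma quad_var_Cons2 [simp]:
  "quad_var x (c # d # \<rho>) = (x d - x c)\<^sup>2 + quad_var x (d # \<rho>)"
proof -
  have "quad_var x (c # d # \<rho>)
      = (\<Sum>i<Suc (length \<rho>). (x ((c # d # \<rho>) ! Suc i) - x ((c # d # \<rho>) ! i))\<^sup>2)"
    by (simp add: quad_var_def)
  also have "\<dots> = (x d - x c)\<^sup>2 + quad_var x (d # \<rho>)"
    unfolding sum.lessThan_Suc_shift by (simp add: quad_var_def)
  finally show ?thesis .
qed

lemma quad_var_nonneg: "0 \<le> quad_var x \<rho>"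
  by (simp add: quad_var_def sum_nonneg)

text \<open>
  Stopping the path turns \<open>quad_var_upto\<close> into an instance of \<open>quad_var\<close>, so that facts about
  \<open>quad_var\<close> for arbitrary paths transfer.
\<close>
lemma quad_var_upto_eq_stopped: "quad_var_upto x \<rho> t = quad_var (\<lambda>s. x (min s t)) \<rho>"
  by (simp add: quad_var_upto_def quad_var_def)

lemma quad_var_concat:
  assumes "\<rho> \<noteq> []" "\<tau> \<noteq> []" "last \<rho> = hd \<tau>"
  shows "quad_var x (\<rho> @ tl \<tau>) = quad_var x \<rho> + quad_var x \<tau>"
  using assms
proof (induction \<rho> rule: induct_list012)
  case (2 c)
  then show ?case by (cases \<tau>) auto
qed auto

lemma quad_var_cong:
  assumes "\<And>s. s \<in> set \<rho> \<Longrightarrow> f s = g s"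
  shows "quad_var f \<rho> = quad_var g \<rho>"
  using assms by (auto simp: quad_var_def intro!: sum.cong)

lemma quad_var_const: "(\<And>s. s \<in> set \<rho> \<Longrightarrow> f s = k) \<Longrightarrow> quad_var f \<rho> = 0"
  using quad_var_cong[of \<rho> f "\<lambda>_. k"] by (simp add: quad_var_def)

lemma quad_var_upto_before:
  "(\<And>s. s \<in> set \<rho> \<Longrightarrow> t \<le> s) \<Longrightarrow> quad_var_upto x \<rho> t = 0"
  unfolding quad_var_upto_eq_stopped by (rule quad_var_const[where k = "x t"]) (simp add: min_absorb2)

lemma quad_var_upto_after:
  "(\<And>s. s \<in> set \<rho> \<Longrightarrow> s \<le> t) \<Longrightarrow> quad_var_upto x \<rho> t = quad_var x \<rho>"
  unfolding quad_var_upto_eq_stopped by (rule quad_var_cong) (simp add: min_absorb1)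

section \<open>Building partitions\<close>

lemma partition_of_bounds:
  assumes "partition_of c d \<rho>" "s \<in> set \<rho>"
  shows "c \<le> s" "s \<le> d"
proof -
  have *: "sorted_wrt (<) \<rho>" "hd \<rho> = c" "last \<rho> = d" "\<rho> \<noteq> []"
    using assms by (auto simp: partition_of_def)
  show "c \<le> s"
    using * assms(2) by (cases \<rho>) auto
  have "\<rho> = butlast \<rho> @ [d]" using *(3,4) append_butlast_last_id[of \<rho>] by simp
  then show "s \<le> d"
    using *(1) assms(2) by (metis Un_iff empty_iff insert_iff less_eq_real_def list.set(1,2)
        set_append sorted_wrt_append)
qed

lemma partition_of_ends: "partition_of c d \<rho> \<Longrightarrow> c \<in> set \<rho> \<and> d \<in> set \<rho>"
  by (auto simp: partition_of_def)

lemma partition_of_Cons: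
  assumes "partition_of d e \<rho>" "c < d"
  shows "partition_of c e (c # \<rho>)"
  using assms partition_of_bounds(1)[OF assms(1)] by (force simp: partition_of_def)

lemma partition_of_tail: "partition_of c e (c' # d # \<rho>) \<Longrightarrow> partition_of d e (d # \<rho>)"
  by (simp add: partition_of_def)

lemma partition_of_concat:
  assumes "partition_of c d \<rho>" "partition_of d e \<tau>"
  shows "partition_of c e (\<rho> @ tl \<tau>)" "set (\<rho> @ tl \<tau>) = set \<rho> \<union> set \<tau>"
    "quad_var f (\<rho> @ tl \<tau>) = quad_var f \<rho> + quad_var f \<tau>"
proof -
  obtain \<tau>' where \<tau>: "\<tau> = d # \<tau>'"
    using assms(2) by (cases \<tau>) (auto simp: partition_of_def)
  have \<rho>: "\<rho> \<noteq> []" "last \<rho> = d" "hd \<rho> = c"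
    using assms(1) by (auto simp: partition_of_def)
  have "sorted_wrt (<) (\<rho> @ \<tau>')"
    using assms partition_of_bounds(2)[OF assms(1)]
    by (force simp: partition_of_def sorted_wrt_append \<tau>)
  then show "partition_of c e (\<rho> @ tl \<tau>)"
    using assms \<rho> by (auto simp: partition_of_def \<tau>)
  show "set (\<rho> @ tl \<tau>) = set \<rho> \<union> set \<tau>"
    using \<rho> last_in_set[of \<rho>] by (auto simp: \<tau>)
  show "quad_var f (\<rho> @ tl \<tau>) = quad_var f \<rho> + quad_var f \<tau>"
    using \<rho> by (intro quad_var_concat) (auto simp: \<tau>)
qed

text \<open>
  A one-point list is a partition of a degenerate interval \<open>[c, c]\<close>. Admitting this case spares
  later constructions the distinction whether an intermediate time falls on an end point.
\<close>
lemma partition_of_coarsest: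
  assumes "c \<le> d"
  obtains \<rho> where "partition_of c d \<rho>" "\<And>f. quad_var f \<rho> = (f d - f c)\<^sup>2"
proof (cases "c = d")
  case True
  then show ?thesis by (intro that[of "[c]"]) (auto simp: partition_of_def)
next
  case False
  then show ?thesis using assms by (intro that[of "[c, d]"]) (auto simp: partition_of_def)
qed

lemma partition_of_sorted_list_of_set:
  assumes "finite S" "c \<in> S" "d \<in> S" "S \<subseteq> {c..d}"
  shows "partition_of c d (sorted_list_of_set S)"
proof -
  let ?l = "sorted_list_of_set S"
  have l: "sorted_wrt (<) ?l" "set ?l = S" "?l \<noteq> []"
    using assms by (auto simp del: set_sorted_list_of_set simp: strict_sorted_list_of_set set_sorted_list_of_set)
  then have p: "partition_of (hd ?l) (last ?l) ?l"
    by (simp add: partition_of_def)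
  have "hd ?l \<in> S" "last ?l \<in> S"
    using l hd_in_set[OF l(3)] last_in_set[OF l(3)] by auto
  then have "hd ?l = c" "last ?l = d"
    using partition_of_bounds[OF p] assms l(2) by (auto intro!: antisym)
  with p show ?thesis by simp
qed

section \<open>Partitions of prescribed quadratic variation\<close>

text \<open>
  At a time where \<open>x\<close> takes the mean of its end values, both increments are half of the whole one,
  so the sum of their squares is half of the square of the whole.
\<close>
lemma partition_quad_var_halving:
  assumes "c \<le> d" "continuous_on {c..d} x"
  shows "\<exists>\<rho>. partition_of c d \<rho> \<and> quad_var x \<rho> \<le> (x d - x c)\<^sup>2 / 2 ^ k"
  using assms
proof (induction k arbitrary: c d)
  case 0
  then show ?case by (metis div_by_1 order_refl partition_of_coarsest power_0)
next
  case (Suc k)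
  obtain m where m: "c \<le> m" "m \<le> d" "x m = (x c + x d) / 2"
  proof (cases "x c \<le> x d")
    case True
    then show ?thesis
      using IVT'[of x c "(x c + x d) / 2" d] Suc.prems that by auto
  next
    case False
    then show ?thesis
      using IVT2'[of x d "(x c + x d) / 2" c] Suc.prems that by auto
  qed
  obtain \<rho> where \<rho>: "partition_of c m \<rho>" "quad_var x \<rho> \<le> (x m - x c)\<^sup>2 / 2 ^ k"
    using Suc.IH[OF m(1) continuous_on_subset[OF Suc.prems(2)]] m by auto
  obtain \<tau> where \<tau>: "partition_of m d \<tau>" "quad_var x \<tau> \<le> (x d - x m)\<^sup>2 / 2 ^ k"
    using Suc.IH[OF m(2) continuous_on_subset[OF Suc.prems(2)]] m by auto
  have halves: "x m - x c = (x d - x c) / 2" "x d - x m = (x d - x c) / 2"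
    using m by (auto simp: field_simps)
  have "(x m - x c)\<^sup>2 / 2 ^ k + (x d - x m)\<^sup>2 / 2 ^ k = (x d - x c)\<^sup>2 / 2 ^ Suc k"
    unfolding halves power_divide by simp
  then show ?case
    using \<rho> \<tau> partition_of_concat[OF \<rho>(1) \<tau>(1)]
    by (intro exI[of _ "\<rho> @ tl \<tau>"]) auto
qed

lemma partition_small_quad_var:
  assumes "c \<le> d" "continuous_on {c..d} x" "\<epsilon> > 0"
  obtains \<rho> where "partition_of c d \<rho>" "quad_var x \<rho> \<le> \<epsilon>"
proof -
  have "(\<lambda>k. (x d - x c)\<^sup>2 * (1 / 2) ^ k) \<longlonglongrightarrow> (x d - x c)\<^sup>2 * 0"
    by (intro tendsto_intros LIMSEQ_power_zero) auto
  then have "\<forall>\<^sub>F k in sequentially. (x d - x c)\<^sup>2 * (1 / 2) ^ k < \<epsilon>"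
    using assms(3) by (intro order_tendstoD) auto
  then obtain k where "(x d - x c)\<^sup>2 / 2 ^ k < \<epsilon>"
    by (auto simp: eventually_sequentially power_divide)
  with partition_quad_var_halving[OF assms(1,2), of k] that show ?thesis
    by fastforce
qed

text \<open>
  The values of \<open>quad_var_upto\<close> are themselves quadratic variations: drop the points after \<open>t\<close>
  and append \<open>t\<close>.
\<close>
lemma partition_truncate:
  assumes "partition_of c d \<rho>" "c \<le> t" "t \<le> d"
  shows "\<exists>\<tau>. partition_of c t \<tau> \<and> quad_var x \<tau> = quad_var_upto x \<rho> t"
  using assms
proof (induction \<rho> arbitrary: c rule: induct_list012)
  case (2 c')
  then show ?case by (auto simp: partition_of_def quad_var_upto_eq_stopped intro!: exI[of _ "[c]"])
next
  case (3 c' e \<rho>)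
  have ce: "c' = c" "c < e" and p: "partition_of e d (e # \<rho>)"
    using "3.prems" by (auto simp: partition_of_def)
  have split: "quad_var_upto x (c' # e # \<rho>) t
      = (x (min e t) - x (min c t))\<^sup>2 + quad_var_upto x (e # \<rho>) t"
    by (simp add: quad_var_upto_eq_stopped ce)
  show ?case
  proof (cases "t \<le> e")
    case True
    obtain \<tau> where "partition_of c t \<tau>" "\<And>f. quad_var f \<tau> = (f t - f c)\<^sup>2"
      using partition_of_coarsest "3.prems"(2) by blast
    moreover have "quad_var_upto x (e # \<rho>) t = 0"
      using partition_of_bounds(1)[OF p] True by (intro quad_var_upto_before) fastforce
    ultimately show ?thesis
      using split True "3.prems"(2) by (auto simp: min_absorb1 min_absorb2)
  next
    case False
    then obtain \<tau> where \<tau>: "partition_of e t \<tau>" "quad_var x \<tau> = quad_var_upto x (e # \<rho>) t"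
      using "3.IH"(2)[OF p] "3.prems" by auto
    moreover have "quad_var x (c # \<tau>) = (x e - x c)\<^sup>2 + quad_var x \<tau>"
      using \<tau>(1) by (cases \<tau>) (auto simp: partition_of_def)
    ultimately show ?thesis
      using split False "3.prems"(2) partition_of_Cons[OF \<tau>(1) ce(2)] ce
      by (intro exI[of _ "c # \<tau>"]) (auto simp: min_absorb1)
  qed
qed (auto simp: partition_of_def)

lemma continuous_on_quad_var_upto:
  assumes "partition_of c d \<rho>" "continuous_on {c..d} x"
  shows "continuous_on {c..d} (quad_var_upto x \<rho>)"
proof -
  have "continuous_on {c..d} (\<lambda>t. x (min s t))" if "s \<in> set \<rho>" for s
    using partition_of_bounds[OF assms(1) that]
    by (intro continuous_on_compose2[OF assms(2)] continuous_intros) auto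
  then show ?thesis
    unfolding quad_var_upto_def by (intro continuous_intros) auto
qed

text \<open>
  The intermediate value theorem is applied in the time variable: a partition with too large a
  quadratic variation is cut at a moment when the running value equals \<open>v\<close>, and the rest of
  the interval is covered at cost at most \<open>\<epsilon>\<close>.
\<close>
lemma partition_prescribed_quad_var:
  assumes x_cont: "continuous_on {c..d} x" and "c \<le> d"
    and large: "partition_of c d \<rho>" "v \<le> quad_var x \<rho>"
    and "0 \<le> v" "\<epsilon> > 0"
  obtains \<tau> where "partition_of c d \<tau>" "\<bar>quad_var x \<tau> - v\<bar> \<le> \<epsilon>"
proof -
  have "quad_var_upto x \<rho> c = 0" "quad_var_upto x \<rho> d = quad_var x \<rho>"
    using partition_of_bounds[OF large(1)]
    by (auto intro: quad_var_upto_before quad_var_upto_after)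
  then obtain t where t: "c \<le> t" "t \<le> d" "quad_var_upto x \<rho> t = v"
    using IVT'[of "quad_var_upto x \<rho>" c v d] assms
      continuous_on_quad_var_upto[OF large(1) x_cont] by auto
  obtain \<tau> where \<tau>: "partition_of c t \<tau>" "quad_var x \<tau> = v"
    using partition_truncate[OF large(1) t(1,2)] t(3) by blast
  obtain \<tau>' where \<tau>': "partition_of t d \<tau>'" "quad_var x \<tau>' \<le> \<epsilon>"
    using partition_small_quad_var[OF t(2) continuous_on_subset[OF x_cont] \<open>\<epsilon> > 0\<close>] t(1)
    by auto
  show ?thesis
    using \<tau> \<tau>' partition_of_concat[OF \<tau>(1) \<tau>'(1)] quad_var_nonneg[of x \<tau>']
    by (intro that[of "\<tau> @ tl \<tau>'"]) auto
qed

text \<open>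
  Partitions of the gaps between consecutive points of \<open>P\<close> are glued together. Each gap spends half of
  the error budget that is left and passes the other half on, so the accumulated error
  stays below \<open>\<epsilon>\<close> at every point of \<open>P\<close>.
\<close>
lemma refine_with_prescribed_quad_var_upto:
  fixes x a :: "real \<Rightarrow> real"
  assumes approx: "\<And>c d \<epsilon>. c \<in> I \<Longrightarrow> d \<in> I \<Longrightarrow> c < d \<Longrightarrow> \<epsilon> > 0 \<Longrightarrow>
      \<exists>\<rho>. partition_of c d \<rho> \<and> \<bar>quad_var x \<rho> - (a d - a c)\<bar> \<le> \<epsilon>"
    and "partition_of c d P" "set P \<subseteq> I" "\<epsilon> > 0"
  shows "\<exists>\<rho>. partition_of c d \<rho> \<and> set P \<subseteq> set \<rho> \<and>
      (\<forall>p\<in>set P. \<bar>quad_var_upto x \<rho> p - (a p - a c)\<bar> \<le> \<epsilon>)"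
  using assms(2-)
proof (induction P arbitrary: c \<epsilon> rule: induct_list012)
  case (2 c')
  then show ?case
    by (auto simp: partition_of_def quad_var_upto_eq_stopped intro!: exI[of _ "[c]"])
next
  case (3 c' e P)
  have c': "c' = c" and ce: "c < e" and p: "partition_of e d (e # P)"
    using "3.prems"(1) by (auto simp: partition_of_def)
  obtain \<rho> where \<rho>: "partition_of c e \<rho>" "\<bar>quad_var x \<rho> - (a e - a c)\<bar> \<le> \<epsilon> / 2"
    using approx[of c e "\<epsilon> / 2"] "3.prems" ce c' by auto
  obtain \<tau> where \<tau>: "partition_of e d \<tau>" "set (e # P) \<subseteq> set \<tau>"
      "\<And>p. p \<in> set (e # P) \<Longrightarrow> \<bar>quad_var_upto x \<tau> p - (a p - a e)\<bar> \<le> \<epsilon> / 2"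
    using "3.IH"(2)[OF p, of "\<epsilon> / 2"] "3.prems" by force
  note con = partition_of_concat[OF \<rho>(1) \<tau>(1)]
  have "\<bar>quad_var_upto x (\<rho> @ tl \<tau>) p - (a p - a c)\<bar> \<le> \<epsilon>" if "p \<in> set (c # e # P)" for p
  proof (cases "p = c")
    case True
    have "quad_var_upto x (\<rho> @ tl \<tau>) c = 0"
      using partition_of_bounds(1)[OF con(1)] by (rule quad_var_upto_before)
    with True "3.prems"(3) show ?thesis by simp
  next
    case False
    then have p': "p \<in> set (e # P)" using that by auto
    have "quad_var_upto x \<rho> p = quad_var x \<rho>"
      using partition_of_bounds(2)[OF \<rho>(1)] partition_of_bounds(1)[OF p p']
      by (intro quad_var_upto_after) force
    then have "quad_var_upto x (\<rho> @ tl \<tau>) p = quad_var x \<rho> + quad_var_upto x \<tau> p"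
      by (simp add: quad_var_upto_eq_stopped con(3))
    with \<rho>(2) \<tau>(3)[OF p'] show ?thesis by linarith
  qed
  moreover have "set (c # e # P) \<subseteq> set (\<rho> @ tl \<tau>)"
    unfolding con(2) using \<tau>(2) partition_of_ends[OF \<rho>(1)] by auto
  ultimately show ?case
    using con(1) c' by blast
qed (auto simp: partition_of_def)

section \<open>Control between the points of a partition\<close>

text \<open>
  At a partition point \<open>s\<close> the sum consists of complete increments only, and these survive
  unchanged at later times. If \<open>s\<close> lies inside a partition interval, this can fail: a path
  may return to its earlier value and lose the square of the incomplete increment.
\<close>
lemma quad_var_upto_mono_from_node:
  assumes "sorted_wrt (<) \<rho>" "s \<in> set \<rho>" "s \<le> t"
  shows "quad_var_upto x \<rho> s \<le> quad_var_upto x \<rho> t"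
  unfolding quad_var_upto_def
proof (rule sum_mono)
  fix i assume i: "i \<in> {..<length \<rho> - 1}"
  obtain j where j: "j < length \<rho>" "s = \<rho> ! j"
    using assms(2) by (auto simp: in_set_conv_nth)
  have mono: "\<rho> ! k \<le> \<rho> ! l" if "k \<le> l" "l < length \<rho>" for k l
    using that sorted_wrt_nth_less[OF assms(1), of k l] by (cases "k = l") auto
  show "(x (min (\<rho> ! Suc i) s) - x (min (\<rho> ! i) s))\<^sup>2
      \<le> (x (min (\<rho> ! Suc i) t) - x (min (\<rho> ! i) t))\<^sup>2"
  proof (cases "j \<le> i")
    case True
    then have "s \<le> \<rho> ! i" "s \<le> \<rho> ! Suc i"
      using mono[of j i] mono[of j "Suc i"] i j by auto
    then show ?thesis by (simp add: min_absorb2)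
  next
    case False
    then have "\<rho> ! i \<le> s" "\<rho> ! Suc i \<le> s"
      using mono[of i j] mono[of "Suc i" j] i j by auto
    then show ?thesis using assms(3) by (simp add: min_absorb1)
  qed
qed

text \<open>
  The excess over a later partition point is at most the square of the incomplete increment. The
  hypothesis \<open>osc\<close> concerns just this one, because its premises make \<open>s\<close> the last
  partition point not after \<open>t\<close>.
\<close>
lemma quad_var_upto_le_at_node:
  assumes "sorted_wrt (<) \<rho>" "\<rho> \<noteq> []" "hd \<rho> \<le> t" "q \<in> set \<rho>" "t \<le> q"
    and osc: "\<And>s. s \<in> set \<rho> \<Longrightarrow> s \<le> t \<Longrightarrow> (\<And>r. r \<in> set \<rho> \<Longrightarrow> r \<le> s \<or> t < r) \<Longrightarrow>
      (x t - x s)\<^sup>2 \<le> \<delta>"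
  shows "quad_var_upto x \<rho> t \<le> quad_var_upto x \<rho> q + \<delta>"
  using assms
proof (induction \<rho> rule: induct_list012)
  case (2 c)
  then have "(x t - x c)\<^sup>2 \<le> \<delta>" by auto
  then have "0 \<le> \<delta>" by (meson order_trans zero_le_power2)
  then show ?case by (simp add: quad_var_upto_eq_stopped)
next
  case (3 c e \<rho>)
  have split: "quad_var_upto x (c # e # \<rho>) r
      = (x (min e r) - x (min c r))\<^sup>2 + quad_var_upto x (e # \<rho>) r" for r
    by (simp add: quad_var_upto_eq_stopped)
  have ce: "c < e" and e: "r \<in> set (e # \<rho>) \<Longrightarrow> e \<le> r" for r
    using "3.prems"(1) by auto
  show ?case
  proof (cases "t < e")
    case True
    have "quad_var_upto x (e # \<rho>) t = 0"
      using e True by (intro quad_var_upto_before) force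
    moreover have "(x t - x c)\<^sup>2 \<le> \<delta>"
      using True e "3.prems"(3) by (intro "3.prems"(6)) force+
    moreover have "0 \<le> quad_var_upto x (c # e # \<rho>) q"
      by (simp only: quad_var_upto_eq_stopped quad_var_nonneg)
    ultimately show ?thesis
      using split[of t] True "3.prems"(3) by (simp add: min_absorb1 min_absorb2)
  next
    case False
    have "quad_var_upto x (e # \<rho>) t \<le> quad_var_upto x (e # \<rho>) q + \<delta>"
    proof (rule "3.IH"(2))
      show "(x t - x s)\<^sup>2 \<le> \<delta>"
        if "s \<in> set (e # \<rho>)" "s \<le> t" "\<And>r. r \<in> set (e # \<rho>) \<Longrightarrow> r \<le> s \<or> t < r" for s
        using that ce e[OF that(1)] by (intro "3.prems"(6)) auto
    qed (use "3.prems" False ce in auto)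
    then show ?thesis
      using split[of t] split[of q] False ce "3.prems"(5) by (simp add: min_absorb1)
  qed
qed auto

lemma finite_unit_dyadics: "finite (unit_dyadics n)"
proof -
  have "unit_dyadics n \<subseteq> (\<lambda>k. real k / 2 ^ n) ` {..2 ^ n}"
  proof
    fix s assume "s \<in> unit_dyadics n"
    then obtain k where "s = real k / 2 ^ n" "real k / 2 ^ n \<le> 1"
      by (auto simp: unit_dyadics_def)
    moreover from this have "real k \<le> real (2 ^ n)"
      by (simp add: field_simps)
    ultimately show "s \<in> (\<lambda>k. real k / 2 ^ n) ` {..2 ^ n}"
      by (auto simp flip: of_nat_le_iff)
  qed
  then show ?thesis by (rule finite_subset) simp
qed

lemma unit_dyadics_bracket:
  assumes "t \<in> {0..1}"
  obtains p q where "p \<in> unit_dyadics n" "q \<in> unit_dyadics n" "p \<le> t" "t \<le> q" "q - p \<le> (1/2) ^ n"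
proof (cases "t = 1")
  case True
  have "1 \<in> unit_dyadics n"
    by (auto simp: unit_dyadics_def intro!: image_eqI[of _ _ "2 ^ n"])
  with True show ?thesis by (intro that[of 1 1]) auto
next
  case False
  define k where "k = nat \<lfloor>t * 2 ^ n\<rfloor>"
  have k: "real k \<le> t * 2 ^ n" "t * 2 ^ n < real k + 1"
    using assms unfolding k_def by auto
  have "t * 2 ^ n < 2 ^ n" using False assms by auto
  then have "real k < 2 ^ n" using k(1) by linarith
  then have "Suc k \<le> 2 ^ n" by (metis Suc_leI of_nat_less_iff of_nat_numeral of_nat_power)
  then have "real (Suc k) \<le> 2 ^ n" by (metis of_nat_le_iff of_nat_numeral of_nat_power)
  then have "j \<le> Suc k \<Longrightarrow> real j \<le> 2 ^ n" for j
    by (rule order_trans[rotated]) simp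
  then have "j \<le> Suc k \<Longrightarrow> real j / 2 ^ n \<in> unit_dyadics n" for j
    unfolding unit_dyadics_def by (intro IntI rangeI) (simp add: field_simps)
  from this[of k] this[of "Suc k"]
  have "real k / 2 ^ n \<in> unit_dyadics n" "real (Suc k) / 2 ^ n \<in> unit_dyadics n"
    by auto
  then show ?thesis
    using k by (intro that[of "real k / 2 ^ n" "real (Suc k) / 2 ^ n"]) (auto simp: field_simps)
qed

text \<open>
  With dyadic neighbours \<open>p \<le> t \<le> q\<close> of \<open>t\<close>, the value at \<open>t\<close> is squeezed between those at
  \<open>p\<close> and \<open>q\<close>. The three error terms are the error at the dyadics, the oscillation of \<open>a\<close> between
  neighbouring dyadics, and the square of the incomplete increment of \<open>x\<close>.
\<close>
lemma quad_var_upto_near_target: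
  assumes \<rho>: "partition_of 0 1 \<rho>" "unit_dyadics n \<subseteq> set \<rho>" and t: "t \<in> {0..1}"
    and nodes: "\<And>p. p \<in> unit_dyadics n \<Longrightarrow> \<bar>quad_var_upto x \<rho> p - a p\<bar> \<le> \<epsilon>"
    and a_mono: "mono_on {0..1} a"
    and a_osc: "\<And>s. s \<in> {0..1} \<Longrightarrow> \<bar>s - t\<bar> \<le> (1/2) ^ n \<Longrightarrow> \<bar>a s - a t\<bar> \<le> \<eta>"
    and x_osc: "\<And>s. s \<in> {0..1} \<Longrightarrow> \<bar>s - t\<bar> \<le> (1/2) ^ n \<Longrightarrow> (x t - x s)\<^sup>2 \<le> \<delta>"
  shows "\<bar>quad_var_upto x \<rho> t - a t\<bar> \<le> \<epsilon> + \<eta> + \<delta>"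
proof -
  obtain p q where pq: "p \<in> unit_dyadics n" "q \<in> unit_dyadics n" "p \<le> t" "t \<le> q" "q - p \<le> (1/2) ^ n"
    using unit_dyadics_bracket[OF t] .
  have in01: "p \<in> {0..1}" "q \<in> {0..1}"
    using pq by (auto simp: unit_dyadics_def)
  have pq_\<rho>: "p \<in> set \<rho>" "q \<in> set \<rho>" using pq \<rho>(2) by auto
  have sorted: "sorted_wrt (<) \<rho>" "\<rho> \<noteq> []" "hd \<rho> \<le> t"
    using \<rho>(1) t by (auto simp: partition_of_def)
  have "quad_var_upto x \<rho> p \<le> quad_var_upto x \<rho> t"
    using sorted(1) pq_\<rho>(1) pq(3) by (rule quad_var_upto_mono_from_node)
  moreover have "quad_var_upto x \<rho> t \<le> quad_var_upto x \<rho> q + \<delta>"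
  proof (rule quad_var_upto_le_at_node[OF sorted pq_\<rho>(2) pq(4)])
    fix s assume s: "s \<in> set \<rho>" "s \<le> t" "\<And>r. r \<in> set \<rho> \<Longrightarrow> r \<le> s \<or> t < r"
    then have "p \<le> s" using pq(3) s(3)[OF pq_\<rho>(1)] by auto
    then show "(x t - x s)\<^sup>2 \<le> \<delta>"
      using s pq partition_of_bounds[OF \<rho>(1) s(1)] by (intro x_osc) auto
  qed
  moreover have "\<bar>a p - a t\<bar> \<le> \<eta>" "\<bar>a q - a t\<bar> \<le> \<eta>"
    using pq in01 by (auto intro!: a_osc)
  moreover have "0 \<le> \<delta>" using x_osc[OF t] by simp
  ultimately show ?thesis
    using nodes[OF pq(1)] nodes[OF pq(2)] by linarith
qed

section \<open>The refining sequence and its limit\<close>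

text \<open>
  Since any finite set of points can be imposed, step \<open>n + 1\<close> imposes all points of the
  partition of step \<open>n\<close> together with \<open>B (n + 1)\<close>. Repeated by dependent choice, this makes
  the sequence refining.
\<close>
lemma refining_partitions_exist:
  fixes x a :: "real \<Rightarrow> real" and B :: "nat \<Rightarrow> real set"
  assumes x_cont: "continuous_on {0..1} x"
    and x_infinite_qv: "\<And>c d. 0 \<le> c \<Longrightarrow> c < d \<Longrightarrow> d \<le> 1 \<Longrightarrow>
      \<exists>\<rho> :: nat \<Rightarrow> real list. (\<forall>n. partition_of c d (\<rho> n)) \<and>
        filterlim (\<lambda>n. quad_var x (\<rho> n)) at_top sequentially"
    and a_mono: "mono_on {0..1} a"
    and a_zero: "a 0 = 0"
    and B: "\<And>n. finite (B n)" "\<And>n. B n \<subseteq> {0..1}"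
  obtains \<pi> :: "nat \<Rightarrow> real list" where "\<And>n. partition_of 0 1 (\<pi> n)" "refining \<pi>"
    "\<And>n. B n \<subseteq> set (\<pi> n)"
    "\<And>n p. p \<in> B n \<Longrightarrow> \<bar>quad_var_upto x (\<pi> n) p - a p\<bar> \<le> (1/2) ^ n"
proof -
  have approx: "\<exists>\<rho>. partition_of c d \<rho> \<and> \<bar>quad_var x \<rho> - (a d - a c)\<bar> \<le> \<epsilon>"
    if "c \<in> {0..1}" "d \<in> {0..1}" "c < d" "\<epsilon> > 0" for c d \<epsilon>
  proof -
    have "0 \<le> c" "d \<le> 1" using that by auto
    from x_infinite_qv[OF this(1) \<open>c < d\<close> this(2)]
    obtain \<rho> where \<rho>: "\<forall>n. partition_of c d (\<rho> n)"
        "filterlim (\<lambda>n. quad_var x (\<rho> n)) at_top sequentially"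
      by blast
    from \<rho>(2) obtain n where "a d - a c \<le> quad_var x (\<rho> n)"
      unfolding filterlim_at_top eventually_sequentially by blast
    moreover have "0 \<le> a d - a c"
      using mono_onD[OF a_mono that(1,2)] that(3) by simp
    moreover have "continuous_on {c..d} x"
      using that by (intro continuous_on_subset[OF x_cont]) auto
    ultimately show ?thesis
      using partition_prescribed_quad_var[of c d x "\<rho> n" "a d - a c" \<epsilon>] \<rho>(1) that
        less_imp_le[OF that(3)] by blast
  qed
  define good where "good n \<rho> \<longleftrightarrow> partition_of 0 1 \<rho> \<and> B n \<subseteq> set \<rho> \<and>
      (\<forall>p\<in>B n. \<bar>quad_var_upto x \<rho> p - a p\<bar> \<le> (1/2) ^ n)" for n \<rho>
  have refine: "\<exists>\<rho>. good n \<rho> \<and> S \<subseteq> set \<rho>" if "finite S" "S \<subseteq> {0..1}" for n S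
  proof -
    let ?P = "sorted_list_of_set ({0, 1} \<union> S \<union> B n)"
    have P: "set ?P = {0, 1} \<union> S \<union> B n"
      using that B by (intro set_sorted_list_of_set) auto
    have "partition_of 0 1 ?P"
      using that B by (intro partition_of_sorted_list_of_set) auto
    moreover have "set ?P \<subseteq> {0..1}"
      unfolding P using that B by auto
    ultimately have "\<exists>\<rho>. partition_of 0 1 \<rho> \<and> set ?P \<subseteq> set \<rho> \<and>
        (\<forall>p\<in>set ?P. \<bar>quad_var_upto x \<rho> p - (a p - a 0)\<bar> \<le> (1/2) ^ n)"
      by (intro refine_with_prescribed_quad_var_upto[where I = "{0..1}"] approx) simp_all
    then show ?thesis
      unfolding P good_def a_zero by force
  qed
  obtain \<pi> where \<pi>: "\<And>n. good n (\<pi> n)" "\<And>n. set (\<pi> n) \<subseteq> set (\<pi> (Suc n))"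
  proof (rule exE[OF dependent_nat_choice[of good "\<lambda>n \<rho> \<tau>. set \<rho> \<subseteq> set \<tau>"]])
    show "\<exists>\<rho>. good 0 \<rho>" using refine[of "{}" 0] by auto
    show "\<exists>\<tau>. good (Suc n) \<tau> \<and> set \<rho> \<subseteq> set \<tau>" if "good n \<rho>" for \<rho> n
      using that partition_of_bounds[of 0 1 \<rho>] by (intro refine) (auto simp: good_def)
  qed blast
  show ?thesis
    using \<pi> by (intro that[of \<pi>]) (auto simp: good_def refining_def)
qed

text \<open>
  The index \<open>N\<close> depends on \<open>e\<close> and on the modulus \<open>d\<close> of continuity of \<open>a\<close>, but not on \<open>t\<close>. This
  covers both modes of convergence: at a single continuity point \<open>d\<close> may vary with \<open>t\<close>, and for a
  uniformly continuous \<open>a\<close> one \<open>d\<close> serves all \<open>t\<close>.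
\<close>
lemma quad_var_upto_eventually_near_target:
  assumes x_cont: "continuous_on {0..1} x" and a_mono: "mono_on {0..1} a"
    and \<pi>: "\<And>n. partition_of 0 1 (\<pi> n)" "\<And>n. unit_dyadics n \<subseteq> set (\<pi> n)"
    and nodes: "\<And>n p. p \<in> unit_dyadics n \<Longrightarrow> \<bar>quad_var_upto x (\<pi> n) p - a p\<bar> \<le> (1/2) ^ n"
    and pos: "e > 0" "d > 0"
  shows "\<exists>N. \<forall>n\<ge>N. \<forall>t\<in>{0..1}. (\<forall>s\<in>{0..1}. dist s t < d \<longrightarrow> dist (a s) (a t) < e / 4) \<longrightarrow>
    dist (quad_var_upto x (\<pi> n) t) (a t) < e"
proof -
  have "uniformly_continuous_on {0..1} x"
    using x_cont by (rule compact_uniformly_continuous) simp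
  then obtain d' where d': "d' > 0" "\<And>s t. s \<in> {0..1} \<Longrightarrow> t \<in> {0..1} \<Longrightarrow> dist s t < d' \<Longrightarrow>
      dist (x s) (x t) < sqrt (e / 4)"
    using pos(1) unfolding uniformly_continuous_on_def by (metis divide_pos_pos real_sqrt_gt_zero zero_less_numeral)
  have "(\<lambda>n. (1/2::real) ^ n) \<longlonglongrightarrow> 0"
    by (rule LIMSEQ_power_zero) simp
  then have "\<forall>\<^sub>F n in sequentially. (1/2::real) ^ n < min (e / 4) (min d d')"
    using pos d'(1) by (intro order_tendstoD) auto
  then obtain N where N: "\<And>n. n \<ge> N \<Longrightarrow> (1/2::real) ^ n < min (e / 4) (min d d')"
    by (auto simp: eventually_sequentially)
  show ?thesis
  proof (intro exI[of _ N] allI impI ballI)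
    fix n t assume n: "N \<le> n" and t: "t \<in> {0..1::real}"
      and at: "\<forall>s\<in>{0..1}. dist s t < d \<longrightarrow> dist (a s) (a t) < e / 4"
    have "\<bar>quad_var_upto x (\<pi> n) t - a t\<bar> \<le> e / 4 + e / 4 + e / 4"
    proof (rule quad_var_upto_near_target[OF \<pi> t _ a_mono])
      show "\<bar>quad_var_upto x (\<pi> n) p - a p\<bar> \<le> e / 4" if "p \<in> unit_dyadics n" for p
        using nodes[OF that] N[OF n] by simp
      show "\<bar>a s - a t\<bar> \<le> e / 4" if "s \<in> {0..1}" "\<bar>s - t\<bar> \<le> (1/2) ^ n" for s
        using at that N[OF n] by (force simp: dist_real_def)
      show "(x t - x s)\<^sup>2 \<le> e / 4" if "s \<in> {0..1}" "\<bar>s - t\<bar> \<le> (1/2) ^ n" for s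
      proof -
        have "\<bar>x t - x s\<bar> < sqrt (e / 4)"
          using d'(2)[OF t that(1)] that(2) N[OF n] by (simp add: dist_real_def abs_minus_commute)
        then have "\<bar>x t - x s\<bar>\<^sup>2 \<le> (sqrt (e / 4))\<^sup>2"
          by (intro power_mono) auto
        then show ?thesis using pos(1) by simp
      qed
    qed
    then show "dist (quad_var_upto x (\<pi> n) t) (a t) < e"
      using pos(1) by (simp add: dist_real_def)
  qed
qed

theorem theorem7p1:
  fixes x a :: "real \<Rightarrow> real"
  assumes x_cont: "continuous_on {0..1} x"
    and x_infinite_qv: "\<And>c d. 0 \<le> c \<Longrightarrow> c < d \<Longrightarrow> d \<le> 1 \<Longrightarrow>
      \<exists>\<rho> :: nat \<Rightarrow> real list. (\<forall>n. partition_of c d (\<rho> n)) \<and>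
        filterlim (\<lambda>n. quad_var x (\<rho> n)) at_top sequentially"
    and a_nonneg: "\<And>t. t \<in> {0..1} \<Longrightarrow> 0 \<le> a t"
    and a_mono: "mono_on {0..1} a"
    and a_zero: "a 0 = 0"
  shows "(\<exists>\<pi> :: nat \<Rightarrow> real list.
      (\<forall>n. partition_of 0 1 (\<pi> n)) \<and> refining \<pi> \<and>
      (\<forall>n. unit_dyadics n \<subseteq> set (\<pi> n)) \<and>
      (\<forall>t\<in>{0..1}. (\<lambda>n. quad_var_upto x (\<pi> n) t) \<longlonglongrightarrow> a t) \<and>
      (continuous_on {0..1} a \<longrightarrow>
        uniform_limit {0..1} (\<lambda>n t. quad_var_upto x (\<pi> n) t) a sequentially)) \<and>
    (\<forall>\<sigma> :: nat \<Rightarrow> real list. (\<forall>n. partition_of 0 1 (\<sigma> n)) \<longrightarrow>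
      (\<exists>\<pi> :: nat \<Rightarrow> real list.
        (\<forall>n. partition_of 0 1 (\<pi> n)) \<and> refining \<pi> \<and>
        (\<forall>n. unit_dyadics n \<subseteq> set (\<pi> n)) \<and>
        (\<forall>n. set (\<sigma> n) \<subseteq> set (\<pi> n)) \<and>
        (\<forall>t\<in>{0..1}. (\<lambda>n. quad_var_upto x (\<pi> n) t) \<longlonglongrightarrow> a t) \<and>
        (continuous_on {0..1} a \<longrightarrow>
          uniform_limit {0..1} (\<lambda>n t. quad_var_upto x (\<pi> n) t) a sequentially)))"
    (is "(\<exists>\<pi>. ?part \<pi> \<and> refining \<pi> \<and> ?dyad \<pi> \<and> ?lim \<pi>) \<and> (\<forall>\<sigma>. ?part \<sigma> \<longrightarrow> (\<exists>\<pi>. ?good \<sigma> \<pi>))")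
proof -
  have main: "\<exists>\<pi>. ?good \<sigma> \<pi>" if \<sigma>: "?part \<sigma>" for \<sigma>
  proof -
    define D where "D = {t\<in>{0..1}. \<not> continuous (at t within {0..1}) a}"
    \<comment> \<open>The point \<open>0\<close> is added because \<open>from_nat_into\<close> enumerates nonempty sets only.\<close>
    define J where "J n = from_nat_into (insert 0 D) ` {..n}" for n :: nat
    have "countable D"
      unfolding D_def by (rule mono_on_ctble_discont[OF a_mono])
    then have J_covers: "\<exists>m. \<forall>n\<ge>m. t \<in> J n" if "t \<in> D" for t
      using from_nat_into_surj[of "insert 0 D" t] that unfolding J_def by force
    have J_sub: "J n \<subseteq> {0..1}" for n
    proof -
      have "J n \<subseteq> insert 0 D" "insert 0 D \<subseteq> {0..1}"
        using from_nat_into[of "insert 0 D"] unfolding J_def by (auto simp: D_def)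
      then show ?thesis by (rule order_trans)
    qed
    define B where "B n = unit_dyadics n \<union> set (\<sigma> n) \<union> J n" for n
    have "finite (B n)" for n
      by (simp add: B_def finite_unit_dyadics J_def)
    moreover have "B n \<subseteq> {0..1}" for n
      using J_sub[of n] \<sigma> partition_of_bounds[of 0 1 "\<sigma> n"]
      by (auto simp: B_def unit_dyadics_def)
    ultimately obtain \<pi> where \<pi>: "\<And>n. partition_of 0 1 (\<pi> n)" "refining \<pi>" "\<And>n. B n \<subseteq> set (\<pi> n)"
        "\<And>n p. p \<in> B n \<Longrightarrow> \<bar>quad_var_upto x (\<pi> n) p - a p\<bar> \<le> (1/2) ^ n"
      using refining_partitions_exist[OF x_cont x_infinite_qv a_mono a_zero, of B] by blast
    have B_sub: "unit_dyadics n \<subseteq> B n" "set (\<sigma> n) \<subseteq> B n" "J n \<subseteq> B n" for n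
      by (auto simp: B_def)
    have near: "\<exists>N. \<forall>n\<ge>N. \<forall>t\<in>{0..1}.
        (\<forall>s\<in>{0..1}. dist s t < d \<longrightarrow> dist (a s) (a t) < e / 4) \<longrightarrow>
        dist (quad_var_upto x (\<pi> n) t) (a t) < e" if "e > 0" "d > 0" for e d
    proof (rule quad_var_upto_eventually_near_target[OF x_cont a_mono \<pi>(1) _ _ that])
      show "unit_dyadics n \<subseteq> set (\<pi> n)" for n
        using \<pi>(3) B_sub(1) by blast
      show "\<bar>quad_var_upto x (\<pi> n) p - a p\<bar> \<le> (1/2) ^ n" if "p \<in> unit_dyadics n" for n p
        using \<pi>(4) B_sub(1) that by blast
    qed
    have "(\<lambda>n. quad_var_upto x (\<pi> n) t) \<longlonglongrightarrow> a t" if t: "t \<in> {0..1}" for t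
    proof (cases "t \<in> D")
      case True
      \<comment> \<open>A jump of \<open>a\<close> is eventually an imposed point, where the error is at most \<open>(1/2) ^ n\<close>.\<close>
      then obtain m where m: "\<And>n. n \<ge> m \<Longrightarrow> t \<in> J n" using J_covers by blast
      have "(\<lambda>n. quad_var_upto x (\<pi> n) t - a t) \<longlonglongrightarrow> 0"
      proof (rule Lim_null_comparison)
        show "\<forall>\<^sub>F n in sequentially. norm (quad_var_upto x (\<pi> n) t - a t) \<le> (1/2) ^ n"
          using m \<pi>(4) B_sub(3) by (force simp: eventually_sequentially)
        show "(\<lambda>n. (1/2::real) ^ n) \<longlonglongrightarrow> 0"
          by (rule LIMSEQ_power_zero) simp
      qed
      then show ?thesis by (rule LIM_zero_cancel)
    next
      case False
      then have cont: "continuous (at t within {0..1}) a" using t by (simp add: D_def)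
      show ?thesis
      proof (rule metric_LIMSEQ_I)
        fix e :: real assume e: "e > 0"
        then have "e / 4 > 0" by simp
        then obtain d where "d > 0" "\<forall>s\<in>{0..1}. dist s t < d \<longrightarrow> dist (a s) (a t) < e / 4"
          using cont unfolding continuous_within_eps_delta by blast
        then show "\<exists>N. \<forall>n\<ge>N. dist (quad_var_upto x (\<pi> n) t) (a t) < e"
          using near[OF e \<open>d > 0\<close>] t by blast
      qed
    qed
    moreover have "uniform_limit {0..1} (\<lambda>n t. quad_var_upto x (\<pi> n) t) a sequentially"
      if "continuous_on {0..1} a"
    proof -
      have uc: "uniformly_continuous_on {0..1} a"
        using that by (rule compact_uniformly_continuous) simp
      show ?thesis
        unfolding uniform_limit_sequentially_iff
      proof (intro allI impI)
        fix e :: real assume e: "e > 0"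
        then have "e / 4 > 0" by simp
        then obtain d where "d > 0"
            "\<forall>t\<in>{0..1}. \<forall>s\<in>{0..1}. dist s t < d \<longrightarrow> dist (a s) (a t) < e / 4"
          using uc unfolding uniformly_continuous_on_def by blast
        then show "\<exists>N. \<forall>n\<ge>N. \<forall>t\<in>{0..1}. dist (quad_var_upto x (\<pi> n) t) (a t) < e"
          using near[OF e \<open>d > 0\<close>] by blast
      qed
    qed
    ultimately show ?thesis
      using \<pi>(1,2) order_trans[OF B_sub(1) \<pi>(3)] order_trans[OF B_sub(2) \<pi>(3)]
      by (intro exI[of _ \<pi>] conjI) simp_all
  qed
  have "?part (\<lambda>_. [0, 1])"
    by (simp add: partition_of_def)
  then obtain \<pi> where "?good (\<lambda>_. [0, 1]) \<pi>"
    using main[of "\<lambda>_. [0, 1]"] by blast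
  then have "\<exists>\<pi>. ?part \<pi> \<and> refining \<pi> \<and> ?dyad \<pi> \<and> ?lim \<pi>"
    by (intro exI[of _ \<pi>]) blast
  then show ?thesis
    using main by (intro conjI allI impI)
qed

end
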